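(* Let $H$ be a Hamiltonian (Hermitian operator) on a multipartite Hilbert space $\mathcal{H}_1\otimes\cdots\otimes\mathcal{H}_n$ of finite dimension. Then the entanglement gap of $H$ is non-zero, $G_E(H)>0$, if and only if no ground state of $H$ is separable.
   Context: A density operator $\rho$ on $\mathcal{H}_1\otimes\cdots\otimes\mathcal{H}_n$ is separable if it is a convex combination of pure product states $|\psi^1\rangle\langle\psi^1|\otimes\cdots\otimes|\psi^n\rangle\langle\psi^n|$ with unit vectors $|\psi^j\rangle\in\mathcal{H}_j$; $\mathcal{S}$ denotes the set of all separable states. A state that is not separable is called entangled. The minimum separable energy is $E_{\mathrm{sep}}=\min_{\rho\in\mathcal{S}}\mathrm{tr}[H\rho]$, the ground-state energy $E_0$ is the smallest eigenvalue of $H$, and the entanglement gap is $G_E=E_{\mathrm{sep}}-E_0$. A ground state is a unit vector in the $E_0$-eigenspace (the ground-state manifold); it is separable if it is a product vector. *)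

theory Defs
  imports "Jordan_Normal_Form.Schur_Decomposition"
begin

text \<open>
  The multipartite space with local dimensions \<open>ds = [d\<^sub>1, \<dots>, d\<^sub>n]\<close> is
  represented in product bases: the factors are \<open>carrier_vec d\<^sub>j\<close> over the complex numbers,
  and their tensor product is \<open>carrier_vec (prod_list ds)\<close>, a basis vector
  \<open>e\<^sub>i \<otimes> e\<^sub>j\<close> of two factors having index \<open>i * d + j\<close> where \<open>d\<close> is the
  dimension of the second factor (the Kronecker convention).
\<close>

definition kron_vec :: "complex vec \<Rightarrow> complex vec \<Rightarrow> complex vec" where
  "kron_vec v w = vec (dim_vec v * dim_vec w)
     (\<lambda>i. v $ (i div dim_vec w) * w $ (i mod dim_vec w))"

definition kron_mat :: "complex mat \<Rightarrow> complex mat \<Rightarrow> complex mat" where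
  "kron_mat A B = mat (dim_row A * dim_row B) (dim_col A * dim_col B)
     (\<lambda>(i, j). A $$ (i div dim_row B, j div dim_col B) * B $$ (i mod dim_row B, j mod dim_col B))"

definition tensor_vecs :: "complex vec list \<Rightarrow> complex vec" where
  "tensor_vecs vs = foldr kron_vec vs (vec 1 (\<lambda>_. 1))"

definition tensor_mats :: "complex mat list \<Rightarrow> complex mat" where
  "tensor_mats As = foldr kron_mat As (1\<^sub>m 1)"

definition hermitian_mat :: "complex mat \<Rightarrow> bool" where
  "hermitian_mat A \<longleftrightarrow> square_mat A \<and> mat_adjoint A = A"

definition mat_trace :: "complex mat \<Rightarrow> complex" where
  "mat_trace A = (\<Sum>i<dim_row A. A $$ (i, i))"

definition is_unit_vector :: "complex vec \<Rightarrow> bool" where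
  "is_unit_vector v \<longleftrightarrow> v \<bullet>c v = 1"

definition ket_bra :: "complex vec \<Rightarrow> complex mat" where
  "ket_bra v = mat (dim_vec v) (dim_vec v) (\<lambda>(i, j). v $ i * cnj (v $ j))"

text \<open>
  The order on the complex numbers is the one of \<open>HOL-Library.Complex_Order\<close>:
  \<open>0 \<le> z\<close> means that \<open>z\<close> is real and non-negative.
\<close>

definition density_operator :: "nat \<Rightarrow> complex mat \<Rightarrow> bool" where
  "density_operator D \<rho> \<longleftrightarrow> \<rho> \<in> carrier_mat D D \<and> hermitian_mat \<rho>
     \<and> (\<forall>v \<in> carrier_vec D. 0 \<le> (\<rho> *\<^sub>v v) \<bullet>c v) \<and> mat_trace \<rho> = 1"

definition pure_product_state :: "nat list \<Rightarrow> complex mat \<Rightarrow> bool" where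
  "pure_product_state ds P \<longleftrightarrow>
     (\<exists>\<psi>s. list_all2 (\<lambda>d \<psi>. \<psi> \<in> carrier_vec d \<and> is_unit_vector \<psi>) ds \<psi>s
         \<and> P = tensor_mats (map ket_bra \<psi>s))"

text \<open>
  The matrix type is not an additive monoid (dimensions vary), so convex combinations
  are written entrywise.
\<close>

definition separable_states :: "nat list \<Rightarrow> complex mat set" where
  "separable_states ds = {\<rho>. density_operator (prod_list ds) \<rho> \<and>
     (\<exists>(m :: nat) (p :: nat \<Rightarrow> real) (P :: nat \<Rightarrow> complex mat).
        (\<forall>k<m. 0 \<le> p k \<and> pure_product_state ds (P k)) \<and> (\<Sum>k<m. p k) = 1 \<and>
        \<rho> = mat (prod_list ds) (prod_list ds)
              (\<lambda>(i, j). \<Sum>k<m. complex_of_real (p k) * P k $$ (i, j)))}"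

text \<open>
  Both minima below are genuine minima (\<open>Least\<close>, not infima). The energies and the
  eigenvalues are real when \<open>H\<close> is Hermitian.
\<close>

definition min_separable_energy :: "nat list \<Rightarrow> complex mat \<Rightarrow> real" where
  "min_separable_energy ds H =
     (LEAST e :: real. \<exists>\<rho> \<in> separable_states ds. mat_trace (H * \<rho>) = complex_of_real e)"

definition ground_energy :: "complex mat \<Rightarrow> real" where
  "ground_energy H = (LEAST e :: real. eigenvalue H (complex_of_real e))"

definition entanglement_gap :: "nat list \<Rightarrow> complex mat \<Rightarrow> real" where
  "entanglement_gap ds H = min_separable_energy ds H - ground_energy H"

definition ground_state :: "complex mat \<Rightarrow> complex vec \<Rightarrow> bool" where
  "ground_state H \<psi> \<longleftrightarrow>
     eigenvector H \<psi> (complex_of_real (ground_energy H)) \<and> is_unit_vector \<psi>"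

definition product_vector :: "nat list \<Rightarrow> complex vec \<Rightarrow> bool" where
  "product_vector ds \<psi> \<longleftrightarrow>
     (\<exists>\<psi>s. list_all2 (\<lambda>d \<phi>. \<phi> \<in> carrier_vec d) ds \<psi>s \<and> \<psi> = tensor_vecs \<psi>s)"

end

(* The energy <v|H|v> is continuous, and both the unit sphere and the set of unit product
   vectors are compact, so it attains its minimum on each. By convexity the minimum separable
   energy is the minimum over unit product vectors. A unit vector minimising the energy on the
   whole sphere is an eigenvector: with w = Hv - E v, the polynomial in t given by the energy
   excess of v + t w is non-negative with vanishing constant term, so its linear coefficient
   2 |w|^2 is zero. Hence the sphere minimum is the ground-state energy, and the gap vanishes
   exactly when some unit product vector is a ground state. *)

theory Submission
  imports Defs "HOL-Analysis.Elementary_Metric_Spaces"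
begin

subsection \<open>The energy form and its minimisers\<close>

text \<open>The expectation value of \<open>H\<close> for a unit vector, kept complex and not
  normalised so that it is the diagonal of a sesquilinear form; \<open>energy_real\<close> disposes
  of the imaginary part for Hermitian \<open>H\<close>.\<close>

definition energy :: "complex mat \<Rightarrow> complex vec \<Rightarrow> complex" where
  "energy H v = (H *\<^sub>v v) \<bullet>c v"

lemma cscalar_prod_sum:
  assumes "v \<in> carrier_vec n" "w \<in> carrier_vec n"
  shows "v \<bullet>c w = (\<Sum>i<n. v $ i * cnj (w $ i))"
  using assms by (auto simp: scalar_prod_def lessThan_atLeast0 intro!: sum.cong)

lemma cscalar_mult_mat_vec_sum:
  fixes H :: "complex mat"
  assumes "H \<in> carrier_mat n n" "u \<in> carrier_vec n" "w \<in> carrier_vec n"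
  shows "(H *\<^sub>v u) \<bullet>c w = (\<Sum>i<n. \<Sum>j<n. H $$ (i, j) * u $ j * cnj (w $ i))"
  using assms
  by (subst cscalar_prod_sum[of _ n])
     (auto simp: scalar_prod_def lessThan_atLeast0 sum_distrib_right intro!: sum.cong)

lemma hermitian_mat_index:
  assumes "hermitian_mat H" "H \<in> carrier_mat n n" "i < n" "j < n"
  shows "cnj (H $$ (i, j)) = H $$ (j, i)"
proof -
  have "mat_adjoint H $$ (j, i) = cnj (H $$ (i, j))"
    using assms(2-4) by (simp add: mat_adjoint_def mat_of_rows_def)
  then show ?thesis using assms(1) by (simp add: hermitian_mat_def)
qed

text \<open>Conjugation turns \<open>H $$ (i, j)\<close> into \<open>H $$ (j, i)\<close>, and
  exchanging the two sums then interchanges the vectors. On the diagonal this makes the energy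
  real.\<close>

lemma hermitian_form_cnj:
  assumes "hermitian_mat H" "H \<in> carrier_mat n n" "u \<in> carrier_vec n" "w \<in> carrier_vec n"
  shows "cnj ((H *\<^sub>v u) \<bullet>c w) = (H *\<^sub>v w) \<bullet>c u"
proof -
  have "cnj ((H *\<^sub>v u) \<bullet>c w) = (\<Sum>i<n. \<Sum>j<n. H $$ (j, i) * w $ i * cnj (u $ j))"
    using assms by (auto simp: cscalar_mult_mat_vec_sum hermitian_mat_index[of H n] intro!: sum.cong)
  also have "\<dots> = (H *\<^sub>v w) \<bullet>c u"
    using assms by (subst sum.swap) (simp add: cscalar_mult_mat_vec_sum)
  finally show ?thesis .
qed

lemma energy_real:
  assumes "hermitian_mat H" "H \<in> carrier_mat n n" "v \<in> carrier_vec n"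
  shows "energy H v = complex_of_real (Re (energy H v))"
  using hermitian_form_cnj[OF assms assms(3)]
  unfolding energy_def by (auto simp: complex_eq_iff)

lemma cscalar_self_real:
  assumes "v \<in> carrier_vec n"
  shows "v \<bullet>c v = complex_of_real (\<Sum>i<n. (cmod (v $ i))\<^sup>2)"
  using assms by (simp add: cscalar_prod_sum complex_norm_square del: of_real_power)

lemma quadratic_nonneg_imp_linear_zero:
  fixes a b :: real
  assumes "\<And>t. 0 \<le> 2 * t * a + t\<^sup>2 * b"
  shows "a = 0"
proof (rule ccontr)
  assume "a \<noteq> 0"
  \<comment> \<open>Since \<open>c\<close> is positive and exceeds \<open>b\<close>, at t =
    \<open>- a / c\<close> the linear term outweighs the quadratic one: their sum is (a/c)^2 (b -
    2c), and b < c < 2c.\<close>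
  define c where "c = \<bar>b\<bar> + 1"
  have c: "c > 0" "b < c" by (auto simp: c_def)
  have "2 * (- a / c) * a + (- a / c)\<^sup>2 * b = (a / c)\<^sup>2 * (b - 2 * c)"
    using c(1) by (simp add: field_simps power2_eq_square)
  moreover have "(a / c)\<^sup>2 * (b - 2 * c) < 0"
    using \<open>a \<noteq> 0\<close> c by (intro mult_pos_neg) auto
  ultimately show False using assms[of "- a / c"] by linarith
qed

text \<open>Conjugation fixes the real number \<open>t\<close>, so along a line the energy is an
  ordinary quadratic polynomial. Applied to the identity matrix, this also expands the squared
  norm.\<close>

lemma energy_line:
  fixes H :: "complex mat"
  assumes "H \<in> carrier_mat n n" "v \<in> carrier_vec n" "w \<in> carrier_vec n"
  shows "energy H (v + complex_of_real t \<cdot>\<^sub>v w) =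
     energy H v + of_real t * ((H *\<^sub>v v) \<bullet>c w + (H *\<^sub>v w) \<bullet>c v) + (of_real t)\<^sup>2 * energy H w"
  unfolding energy_def using assms
  by (simp add: cscalar_mult_mat_vec_sum)
     (simp add: algebra_simps power2_eq_square sum.distrib sum_distrib_left)

text \<open>The bound \<open>min\<close> is the Rayleigh quotient bound cleared of its denominator,
  so the perturbed vector \<open>v\<close> + t \<open>w\<close> never has to be normalised.\<close>

lemma minimizer_is_eigenvector:
  assumes H: "hermitian_mat H" "H \<in> carrier_mat n n" and v: "v \<in> carrier_vec n"
    and min: "\<And>u. u \<in> carrier_vec n \<Longrightarrow> m * Re (u \<bullet>c u) \<le> Re (energy H u)"
    and eq: "Re (energy H v) = m * Re (v \<bullet>c v)"
  shows "H *\<^sub>v v = complex_of_real m \<cdot>\<^sub>v v"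
proof -
  define w where "w = H *\<^sub>v v - complex_of_real m \<cdot>\<^sub>v v"
  have w: "w \<in> carrier_vec n" using H v by (simp add: w_def)
  \<comment> \<open>Reading the squared norm as the energy of the identity lets
    \<open>energy_line\<close> expand both sides of \<open>min\<close>.\<close>
  have one: "energy (1\<^sub>m n) u = u \<bullet>c u" if "u \<in> carrier_vec n" for u
    using that by (simp add: energy_def)
  have sym: "Re ((H *\<^sub>v w) \<bullet>c v) = Re ((H *\<^sub>v v) \<bullet>c w)"
    using arg_cong[OF hermitian_form_cnj[OF H v w], of Re] by simp
  have sym1: "Re (w \<bullet>c v) = Re (v \<bullet>c w)"
    using v w by (simp add: cscalar_prod_sum algebra_simps)
  \<comment> \<open>Only the left factor is expanded. The real part is then half the linear
    coefficient of the energy minus \<open>m\<close> times half that of the squared norm, which is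
    half the linear coefficient of the excess.\<close>
  have "w \<bullet>c w = (H *\<^sub>v v) \<bullet>c w - complex_of_real m * (v \<bullet>c w)"
    using H v w by (subst (1) w_def) (simp add: minus_scalar_prod_distrib[of _ n])
  then have ww: "Re (w \<bullet>c w) = Re ((H *\<^sub>v v) \<bullet>c w) - m * Re (v \<bullet>c w)" by simp
  have "0 \<le> 2 * t * Re (w \<bullet>c w) + t\<^sup>2 * (Re (energy H w) - m * Re (w \<bullet>c w))" for t
  proof -
    let ?u = "v + complex_of_real t \<cdot>\<^sub>v w"
    have u: "?u \<in> carrier_vec n" using v w by simp
    have "Re (energy H ?u) = m * Re (v \<bullet>c v) + 2 * t * Re ((H *\<^sub>v v) \<bullet>c w) + t\<^sup>2 * Re (energy H w)"
      using energy_line[OF H(2) v w, of t] sym eq by (simp add: power2_eq_square algebra_simps)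
    moreover have "Re (?u \<bullet>c ?u) = Re (v \<bullet>c v) + 2 * t * Re (v \<bullet>c w) + t\<^sup>2 * Re (w \<bullet>c w)"
      using energy_line[OF one_carrier_mat v w, of t] sym1 v w
      unfolding one[OF u] one[OF v] one[OF w] by (simp add: power2_eq_square algebra_simps)
    ultimately have "m * (Re (v \<bullet>c v) + 2 * t * Re (v \<bullet>c w) + t\<^sup>2 * Re (w \<bullet>c w))
        \<le> m * Re (v \<bullet>c v) + 2 * t * Re ((H *\<^sub>v v) \<bullet>c w) + t\<^sup>2 * Re (energy H w)"
      using min[OF u] by simp
    moreover have "2 * t * Re (w \<bullet>c w) = 2 * t * Re ((H *\<^sub>v v) \<bullet>c w) - m * (2 * t * Re (v \<bullet>c w))"
      unfolding ww by (simp add: algebra_simps)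
    ultimately show ?thesis by (simp add: algebra_simps)
  qed
  then have "Re (w \<bullet>c w) = 0" by (rule quadratic_nonneg_imp_linear_zero)
  then have "w \<bullet>c w = 0" using w by (simp add: cscalar_self_real)
  then have "w = 0\<^sub>v n" using w by simp
  then have "(H *\<^sub>v v - complex_of_real m \<cdot>\<^sub>v v) $ i = 0" if "i < n" for i
    using that by (simp add: w_def)
  then show ?thesis using H v by (intro eq_vecI) auto
qed

subsection \<open>Sequential compactness\<close>

text \<open>
  The type of vectors of varying dimension carries no topology, so compactness is expressed by
  coordinatewise convergent subsequences.
\<close>

definition vec_seq_compact :: "nat \<Rightarrow> complex vec set \<Rightarrow> bool" where
  "vec_seq_compact n S \<longleftrightarrow> S \<subseteq> carrier_vec n \<and>
     (\<forall>X. (\<forall>k. X k \<in> S) \<longrightarrow>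
        (\<exists>v\<in>S. \<exists>r :: nat \<Rightarrow> nat. strict_mono r \<and> (\<forall>i<n. (\<lambda>k. X (r k) $ i) \<longlonglongrightarrow> v $ i)))"

text \<open>Bolzano-Weierstrass for the pairs of real and imaginary parts, carried back to the
  complex numbers by componentwise convergence.\<close>

lemma bounded_complex_seq_convergent_subseq:
  fixes f :: "nat \<Rightarrow> complex"
  assumes "\<And>k. cmod (f k) \<le> B"
  shows "\<exists>l r. strict_mono (r :: nat \<Rightarrow> nat) \<and> (\<lambda>k. f (r k)) \<longlonglongrightarrow> l"
proof -
  have "cmod (f k) \<le> B \<Longrightarrow> norm (Re (f k)) \<le> B \<and> norm (Im (f k)) \<le> B" for k
    using abs_Re_le_cmod[of "f k"] abs_Im_le_cmod[of "f k"] by auto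
  then have "bounded (range (Re \<circ> f))" "bounded (range (Im \<circ> f))"
    unfolding bounded_iff using assms by auto
  then have "bounded (range (Re \<circ> f) \<times> range (Im \<circ> f))" by (rule bounded_Times)
  then have "bounded (range (\<lambda>k. (Re (f k), Im (f k))))" by (rule bounded_subset) auto
  then obtain l r where r: "strict_mono (r :: nat \<Rightarrow> nat)"
    and l: "(\<lambda>k. (Re (f (r k)), Im (f (r k)))) \<longlonglongrightarrow> l"
    using bounded_imp_convergent_subsequence by (force simp: o_def)
  have "(\<lambda>k. f (r k)) \<longlonglongrightarrow> Complex (fst l) (snd l)"
    using tendsto_fst[OF l] tendsto_snd[OF l] by (simp add: tendsto_complex_iff)
  with r show ?thesis by blast
qed

text \<open>Coordinates are treated one at a time: a subsequence serving the first \<open>n\<close>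
  is thinned out further for the next one, and limits already obtained survive thinning.\<close>

lemma bounded_coordinates_convergent_subseq:
  fixes f :: "nat \<Rightarrow> nat \<Rightarrow> complex"
  assumes "\<And>k i. i < n \<Longrightarrow> cmod (f k i) \<le> B"
  shows "\<exists>l r. strict_mono (r :: nat \<Rightarrow> nat) \<and> (\<forall>i<n. (\<lambda>k. f (r k) i) \<longlonglongrightarrow> l i)"
  using assms
proof (induction n)
  case 0
  then show ?case using strict_mono_id by auto
next
  case (Suc n)
  then obtain l r where r: "strict_mono (r :: nat \<Rightarrow> nat)"
    and l: "\<And>i. i < n \<Longrightarrow> (\<lambda>k. f (r k) i) \<longlonglongrightarrow> l i"
    by (metis less_Suc_eq)
  obtain a s where s: "strict_mono (s :: nat \<Rightarrow> nat)" and a: "(\<lambda>k. f (r (s k)) n) \<longlonglongrightarrow> a"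
    using bounded_complex_seq_convergent_subseq[of "\<lambda>k. f (r k) n" B] Suc.prems by auto
  have "(\<lambda>k. f ((r \<circ> s) k) i) \<longlonglongrightarrow> (l(n := a)) i" if "i < Suc n" for i
    using that a LIMSEQ_subseq_LIMSEQ[OF l s, of i] by (cases "i = n") (auto simp: o_def)
  with strict_mono_o[OF r s] show ?case by blast
qed

definition unit_sphere :: "nat \<Rightarrow> complex vec set" where
  "unit_sphere n = {v \<in> carrier_vec n. is_unit_vector v}"

lemma unit_sphere_iff:
  "v \<in> unit_sphere n \<longleftrightarrow> v \<in> carrier_vec n \<and> (\<Sum>i<n. (cmod (v $ i))\<^sup>2) = 1"
  unfolding unit_sphere_def is_unit_vector_def
  by (auto simp: cscalar_self_real simp del: of_real_sum)

text \<open>Coordinates of unit vectors have modulus at most 1, so a coordinatewise limit exists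
  along a subsequence. The sum of squared moduli is constantly 1 along it and continuous in the
  coordinates, so the limit is again a unit vector.\<close>

lemma vec_seq_compact_unit_sphere: "vec_seq_compact n (unit_sphere n)"
  unfolding vec_seq_compact_def
proof (intro conjI allI impI)
  show "unit_sphere n \<subseteq> carrier_vec n" by (auto simp: unit_sphere_def)
  fix X :: "nat \<Rightarrow> complex vec"
  assume X: "\<forall>k. X k \<in> unit_sphere n"
  have "cmod (X k $ i) \<le> 1" if "i < n" for k i
  proof -
    have "(cmod (X k $ i))\<^sup>2 \<le> (\<Sum>i<n. (cmod (X k $ i))\<^sup>2)"
      using that by (intro member_le_sum) auto
    also have "\<dots> = 1" using X by (simp add: unit_sphere_iff)
    finally show ?thesis by (simp add: abs_square_le_1)
  qed
  then obtain l r where r: "strict_mono (r :: nat \<Rightarrow> nat)"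
    and l: "\<And>i. i < n \<Longrightarrow> (\<lambda>k. X (r k) $ i) \<longlonglongrightarrow> l i"
    using bounded_coordinates_convergent_subseq[of n "\<lambda>k i. X k $ i" 1] by auto
  have "(\<lambda>k. \<Sum>i<n. (cmod (X (r k) $ i))\<^sup>2) \<longlonglongrightarrow> (\<Sum>i<n. (cmod (l i))\<^sup>2)"
    by (intro tendsto_intros l) auto
  then have "(\<Sum>i<n. (cmod (l i))\<^sup>2) = 1"
    using X by (simp add: unit_sphere_iff LIMSEQ_const_iff)
  then have "vec n l \<in> unit_sphere n" by (simp add: unit_sphere_iff)
  with r l show "\<exists>v\<in>unit_sphere n. \<exists>r :: nat \<Rightarrow> nat. strict_mono r \<and> (\<forall>i<n. (\<lambda>k. X (r k) $ i) \<longlonglongrightarrow> v $ i)"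
    by (intro bexI[of _ "vec n l"] exI[of _ r]) auto
qed

text \<open>Compactness is moved to the real line: the energy is a polynomial in the coordinates and
  their conjugates, so its values on \<open>S\<close> form a sequentially compact set of reals,
  which contains its infimum.\<close>

lemma energy_attains_min:
  assumes H: "H \<in> carrier_mat n n" and S: "vec_seq_compact n S" "S \<noteq> {}"
  shows "\<exists>v\<in>S. \<forall>u\<in>S. Re (energy H v) \<le> Re (energy H u)"
proof -
  have "seq_compact ((\<lambda>v. Re (energy H v)) ` S)"
    unfolding seq_compact_def
  proof (intro allI impI)
    fix f :: "nat \<Rightarrow> real"
    assume "\<forall>k. f k \<in> (\<lambda>v. Re (energy H v)) ` S"
    then have "\<forall>k. \<exists>v\<in>S. f k = Re (energy H v)" by auto
    then obtain X where X: "\<And>k. X k \<in> S" "\<And>k. f k = Re (energy H (X k))" by metis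
    with S obtain v r where v: "v \<in> S" and r: "strict_mono (r :: nat \<Rightarrow> nat)"
      and lim: "\<And>i. i < n \<Longrightarrow> (\<lambda>k. X (r k) $ i) \<longlonglongrightarrow> v $ i"
      unfolding vec_seq_compact_def by metis
    have eq: "energy H u = (\<Sum>i<n. \<Sum>j<n. H $$ (i, j) * u $ j * cnj (u $ i))" if "u \<in> S" for u
      using that S H by (auto simp: energy_def vec_seq_compact_def cscalar_mult_mat_vec_sum)
    have "(\<lambda>k. energy H (X (r k))) \<longlonglongrightarrow> energy H v"
      unfolding eq[OF X(1)] eq[OF v] by (intro tendsto_intros lim) auto
    then have "(f \<circ> r) \<longlonglongrightarrow> Re (energy H v)"
      by (simp add: o_def X(2) tendsto_Re)
    with v r show "\<exists>l\<in>(\<lambda>v. Re (energy H v)) ` S. \<exists>r. strict_mono r \<and> (f \<circ> r) \<longlonglongrightarrow> l" by blast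
  qed
  then have "compact ((\<lambda>v. Re (energy H v)) ` S)" by (simp add: compact_eq_seq_compact_metric)
  from compact_attains_inf[OF this] S(2) show ?thesis by auto
qed

section \<open>Kronecker products of sequentially compact sets\<close>

lemma kron_vec_carrier:
  "v \<in> carrier_vec m \<Longrightarrow> w \<in> carrier_vec n \<Longrightarrow> kron_vec v w \<in> carrier_vec (m * n)"
  by (auto simp: kron_vec_def)

lemma kron_vec_index:
  "v \<in> carrier_vec m \<Longrightarrow> w \<in> carrier_vec n \<Longrightarrow> i < m * n \<Longrightarrow>
    kron_vec v w $ i = v $ (i div n) * w $ (i mod n)"
  by (auto simp: kron_vec_def)

lemma kron_index_bounds:
  fixes i m n :: nat
  assumes "i < m * n"
  shows "i div n < m" "i mod n < n"
proof -
  have "0 < n" using assms by (cases n) auto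
  then show "i mod n < n" by simp
  show "i div n < m" using assms by (rule less_mult_imp_div_less)
qed

text \<open>A subsequence \<open>r\<close> makes the left factors converge, and a further one
  \<open>s\<close> the right factors; every entry of the product is one coordinate of each, so it
  converges along \<open>r \<circ> s\<close>.\<close>

lemma vec_seq_compact_kron:
  assumes S: "vec_seq_compact m S" and T: "vec_seq_compact n T"
  shows "vec_seq_compact (m * n) {kron_vec v w | v w. v \<in> S \<and> w \<in> T}"
  unfolding vec_seq_compact_def
proof (intro conjI allI impI)
  have sub: "S \<subseteq> carrier_vec m" "T \<subseteq> carrier_vec n"
    using S T by (auto simp: vec_seq_compact_def)
  then show "{kron_vec v w | v w. v \<in> S \<and> w \<in> T} \<subseteq> carrier_vec (m * n)"
    by (auto intro: kron_vec_carrier)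
  fix X :: "nat \<Rightarrow> complex vec"
  assume "\<forall>k. X k \<in> {kron_vec v w | v w. v \<in> S \<and> w \<in> T}"
  then have "\<forall>k. \<exists>v w. X k = kron_vec v w \<and> v \<in> S \<and> w \<in> T" by auto
  then obtain V W where VW: "\<And>k. X k = kron_vec (V k) (W k)" "\<And>k. V k \<in> S" "\<And>k. W k \<in> T"
    by metis
  obtain v r where v: "v \<in> S" and r: "strict_mono (r :: nat \<Rightarrow> nat)"
    and rv: "\<And>i. i < m \<Longrightarrow> (\<lambda>k. V (r k) $ i) \<longlonglongrightarrow> v $ i"
    using S VW(2) unfolding vec_seq_compact_def by metis
  have "\<forall>k. (W \<circ> r) k \<in> T" using VW(3) by simp
  then obtain w s where w: "w \<in> T" and s: "strict_mono (s :: nat \<Rightarrow> nat)"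
    and sw: "\<And>i. i < n \<Longrightarrow> (\<lambda>k. (W \<circ> r) (s k) $ i) \<longlonglongrightarrow> w $ i"
    using T unfolding vec_seq_compact_def by metis
  have entry: "kron_vec v w $ i = v $ (i div n) * w $ (i mod n)"
    if "v \<in> S" "w \<in> T" "i < m * n" for v w i
    using that sub by (intro kron_vec_index) auto
  have "(\<lambda>k. X ((r \<circ> s) k) $ i) \<longlonglongrightarrow> kron_vec v w $ i" if i: "i < m * n" for i
    using tendsto_mult[OF LIMSEQ_subseq_LIMSEQ[OF rv s] sw] kron_index_bounds[OF i]
    by (simp add: o_def VW entry v w i)
  with v w strict_mono_o[OF r s]
  show "\<exists>u\<in>{kron_vec v w | v w. v \<in> S \<and> w \<in> T}. \<exists>r :: nat \<Rightarrow> nat. strict_mono r \<and>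
      (\<forall>i<m * n. (\<lambda>k. X (r k) $ i) \<longlonglongrightarrow> u $ i)" by blast
qed

subsection \<open>Unit product vectors\<close>

text \<open>The index range splits into \<open>m\<close> consecutive blocks of length
  \<open>n\<close>; on block \<open>a\<close> the quotient is constantly \<open>a\<close> and the
  remainder is the offset in the block.\<close>

lemma sum_kron_index:
  fixes f :: "nat \<Rightarrow> nat \<Rightarrow> 'a :: comm_monoid_add"
  shows "(\<Sum>i<m * n. f (i div n) (i mod n)) = (\<Sum>a<m. \<Sum>b<n. f a b)"
proof -
  have "(\<Sum>i<m * n. f (i div n) (i mod n)) =
      (\<Sum>a<m. \<Sum>i\<in>{a * n..<a * n + n}. f (i div n) (i mod n))"
    using sum.nat_group[of "\<lambda>i. f (i div n) (i mod n)" n m] by simp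
  also have "\<dots> = (\<Sum>a<m. \<Sum>b<n. f a b)"
  proof (rule sum.cong[OF refl])
    fix a
    show "(\<Sum>i\<in>{a * n..<a * n + n}. f (i div n) (i mod n)) = (\<Sum>b<n. f a b)"
    proof (rule sum.reindex_bij_witness[of _ "\<lambda>b. a * n + b" "\<lambda>i. i - a * n"])
      fix i assume i: "i \<in> {a * n..<a * n + n}"
      then have "i div n = a" by (intro div_nat_eqI) (auto simp: algebra_simps)
      moreover have "i mod n = i - a * n"
        using minus_div_mult_eq_mod[of i n] by (simp add: \<open>i div n = a\<close>)
      ultimately show "f a (i - a * n) = f (i div n) (i mod n)" by simp
    qed auto
  qed
  finally show ?thesis .
qed

lemma kron_vec_cscalar_self:
  assumes "v \<in> carrier_vec m" "w \<in> carrier_vec n"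
  shows "kron_vec v w \<bullet>c kron_vec v w = (v \<bullet>c v) * (w \<bullet>c w)"
proof -
  have "kron_vec v w \<bullet>c kron_vec v w =
      (\<Sum>i<m * n. (v $ (i div n) * w $ (i mod n)) * cnj (v $ (i div n) * w $ (i mod n)))"
    using cscalar_prod_sum[OF kron_vec_carrier[OF assms] kron_vec_carrier[OF assms]] assms
    by (simp add: kron_vec_index)
  also have "\<dots> = (\<Sum>a<m. \<Sum>b<n. (v $ a * w $ b) * cnj (v $ a * w $ b))"
    by (rule sum_kron_index)
  also have "\<dots> = (v \<bullet>c v) * (w \<bullet>c w)"
    using assms by (simp add: cscalar_prod_sum sum_product algebra_simps)
  finally show ?thesis .
qed

text \<open>Each factor is normalised separately, so the set arises recursively from unit spheres
  and inherits their compactness. \<open>unit_product_vector_in_unit_products\<close> shows that no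
  unit product vector is lost.\<close>

definition unit_products :: "nat list \<Rightarrow> complex vec set" where
  "unit_products ds = tensor_vecs ` {\<psi>s. list_all2 (\<lambda>d \<psi>. \<psi> \<in> unit_sphere d) ds \<psi>s}"

lemma unit_products_Nil: "unit_products [] = {vec 1 (\<lambda>_. 1)}"
  by (auto simp: unit_products_def tensor_vecs_def)

lemma unit_products_Cons:
  "unit_products (d # ds) = {kron_vec v w | v w. v \<in> unit_sphere d \<and> w \<in> unit_products ds}"
  by (force simp: unit_products_def tensor_vecs_def list_all2_Cons1)

lemma unit_products_subset: "unit_products ds \<subseteq> unit_sphere (prod_list ds)"
proof (induction ds)
  case Nil
  show ?case by (auto simp: unit_products_Nil unit_sphere_iff)
next
  case (Cons d ds)
  then show ?case
    by (force simp: unit_products_Cons unit_sphere_def is_unit_vector_def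
        kron_vec_cscalar_self intro: kron_vec_carrier)
qed

lemma vec_seq_compact_unit_products: "vec_seq_compact (prod_list ds) (unit_products ds)"
proof (induction ds)
  case Nil
  show ?case by (auto simp: unit_products_Nil vec_seq_compact_def intro: strict_mono_id)
next
  case (Cons d ds)
  then show ?case
    using vec_seq_compact_kron[OF vec_seq_compact_unit_sphere] by (simp add: unit_products_Cons)
qed

section \<open>Non-emptiness and normalisation of factors\<close>

lemma unit_sphere_nonempty:
  assumes "1 \<le> n"
  shows "unit_sphere n \<noteq> {}"
proof -
  have "unit_vec n 0 \<in> unit_sphere n"
    using assms sum.delta[of "{..<n}" 0 "\<lambda>_. 1 :: real"]
    by (simp add: unit_sphere_def is_unit_vector_def scalar_prod_left_unit[of _ n])
  then show ?thesis by auto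
qed

lemma unit_products_nonempty:
  assumes "\<forall>d\<in>set ds. 1 \<le> d"
  shows "unit_products ds \<noteq> {}"
  using assms
proof (induction ds)
  case Nil
  show ?case by (simp add: unit_products_Nil)
next
  case (Cons d ds)
  then show ?case using unit_sphere_nonempty[of d] by (force simp: unit_products_Cons)
qed

text \<open>Splits a vector into length and direction. The zero vector gets length 0 and an
  arbitrary direction, which exists in positive dimension.\<close>

lemma vec_eq_smult_unit:
  assumes "v \<in> carrier_vec n" "1 \<le> n"
  shows "\<exists>c\<ge>0. \<exists>u\<in>unit_sphere n. v = complex_of_real c \<cdot>\<^sub>v u"
proof (cases "v = 0\<^sub>v n")
  case True
  obtain u where "u \<in> unit_sphere n" using unit_sphere_nonempty[OF assms(2)] by auto
  with True show ?thesis by (intro exI[of _ 0] conjI bexI[of _ u]) (auto simp: unit_sphere_def)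
next
  case False
  define s where "s = (\<Sum>i<n. (cmod (v $ i))\<^sup>2)"
  have s: "v \<bullet>c v = complex_of_real s"
    unfolding s_def by (rule cscalar_self_real[OF assms(1)])
  have "s \<noteq> 0" using False s assms(1) by auto
  moreover have "0 \<le> s" unfolding s_def by (intro sum_nonneg) auto
  ultimately have pos: "0 < s" by simp
  define u where "u = complex_of_real (1 / sqrt s) \<cdot>\<^sub>v v"
  have "(\<Sum>i<n. (cmod (u $ i))\<^sup>2) = (\<Sum>i<n. (cmod (v $ i))\<^sup>2 / s)"
    using assms(1) pos by (intro sum.cong) (auto simp: u_def norm_divide power_divide)
  also have "\<dots> = 1" using pos by (simp add: s_def sum_divide_distrib[symmetric])
  finally have "u \<in> unit_sphere n" using assms(1) by (simp add: unit_sphere_iff u_def)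
  moreover have "v = complex_of_real (sqrt s) \<cdot>\<^sub>v u"
    using assms(1) pos by (intro eq_vecI) (auto simp: u_def)
  ultimately show ?thesis using pos by (intro exI[of _ "sqrt s"]) auto
qed

lemma kron_vec_smult:
  "kron_vec (a \<cdot>\<^sub>v v) (b \<cdot>\<^sub>v w) = (a * b) \<cdot>\<^sub>v kron_vec v w"
  by (intro eq_vecI) (auto simp: kron_vec_def kron_index_bounds)

text \<open>
  Allowing the scalar 0 covers a vanishing factor without a case distinction.
\<close>

lemma tensor_vecs_eq_smult_unit_product:
  assumes "list_all2 (\<lambda>d \<phi>. \<phi> \<in> carrier_vec d) ds \<psi>s" "\<forall>d\<in>set ds. 1 \<le> d"
  shows "\<exists>c\<ge>0. \<exists>u\<in>unit_products ds. tensor_vecs \<psi>s = complex_of_real c \<cdot>\<^sub>v u"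
  using assms
proof (induction ds \<psi>s rule: list_all2_induct)
  case Nil
  show ?case
    by (intro exI[of _ 1]) (auto simp: unit_products_Nil tensor_vecs_def)
next
  case (Cons d ds v \<psi>s)
  obtain a u where a: "0 \<le> a" "u \<in> unit_sphere d" "v = complex_of_real a \<cdot>\<^sub>v u"
    using vec_eq_smult_unit[of v d] Cons by auto
  obtain c w where c: "0 \<le> c" "w \<in> unit_products ds" "tensor_vecs \<psi>s = complex_of_real c \<cdot>\<^sub>v w"
    using Cons by auto
  have "tensor_vecs (v # \<psi>s) = complex_of_real (a * c) \<cdot>\<^sub>v kron_vec u w"
    using a(3) c(3) by (simp add: tensor_vecs_def kron_vec_smult)
  moreover have "kron_vec u w \<in> unit_products (d # ds)" using a c by (auto simp: unit_products_Cons)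
  ultimately show ?case using a(1) c(1) by (intro exI[of _ "a * c"]) auto
qed

text \<open>The lengths of the factors collect into one scalar \<open>c\<close>, whose square is the
  squared norm 1. Since \<open>c\<close> is a non-negative real, it equals 1 and no phase
  remains.\<close>

lemma unit_product_vector_in_unit_products:
  assumes "product_vector ds \<psi>" "is_unit_vector \<psi>" "\<forall>d\<in>set ds. 1 \<le> d"
  shows "\<psi> \<in> unit_products ds"
proof -
  obtain c u where c: "0 \<le> c" "u \<in> unit_products ds" "\<psi> = complex_of_real c \<cdot>\<^sub>v u"
    using tensor_vecs_eq_smult_unit_product assms(1,3) unfolding product_vector_def by metis
  have u: "u \<in> carrier_vec (prod_list ds)" "u \<bullet>c u = 1"
    using c(2) unit_products_subset by (auto simp: unit_sphere_def is_unit_vector_def)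
  have "complex_of_real (c * c) = 1"
    using assms(2) u unfolding c(3) is_unit_vector_def by (simp add: conjugate_smult_vec)
  then have "c * c = 1" using of_real_eq_1_iff by blast
  with c(1) have "c = 1" by (simp add: square_eq_1_iff)
  with c show ?thesis by simp
qed

lemma unit_products_product_vector: "\<psi> \<in> unit_products ds \<Longrightarrow> product_vector ds \<psi>"
  by (auto simp: unit_products_def product_vector_def unit_sphere_def elim!: list_all2_mono)

section \<open>Pure product states as rank-one projectors\<close>

lemma kron_mat_ket_bra: "kron_mat (ket_bra v) (ket_bra w) = ket_bra (kron_vec v w)"
  by (intro eq_matI) (auto simp: kron_mat_def ket_bra_def kron_vec_def kron_index_bounds)

lemma tensor_mats_ket_bra: "tensor_mats (map ket_bra vs) = ket_bra (tensor_vecs vs)"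
proof (induction vs)
  case Nil
  show ?case by (intro eq_matI) (auto simp: tensor_mats_def tensor_vecs_def ket_bra_def)
next
  case (Cons v vs)
  then show ?case by (simp add: tensor_mats_def tensor_vecs_def kron_mat_ket_bra)
qed

lemma pure_product_state_iff:
  "pure_product_state ds P \<longleftrightarrow> (\<exists>v\<in>unit_products ds. P = ket_bra v)"
  by (auto simp: pure_product_state_def unit_products_def unit_sphere_def tensor_mats_ket_bra)

subsection \<open>Ground-state energy and minimum separable energy\<close>

text \<open>The trace is linear in the state, so a mixture has the weighted average of the energies
  of its components. This is where convexity enters.\<close>

lemma mat_trace_mult_mixture:
  fixes p :: "nat \<Rightarrow> real"
  assumes H: "H \<in> carrier_mat n n" and v: "\<And>k. k < m \<Longrightarrow> v k \<in> carrier_vec n"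
  shows "mat_trace (H * mat n n (\<lambda>(i, j). \<Sum>k<m. complex_of_real (p k) * ket_bra (v k) $$ (i, j)))
    = (\<Sum>k<m. complex_of_real (p k) * energy H (v k))"
proof -
  have ket: "ket_bra (v k) $$ (j, i) = v k $ j * cnj (v k $ i)" if "k < m" "i < n" "j < n" for i j k
    using v[OF that(1)] that by (auto simp: ket_bra_def)
  have "mat_trace (H * mat n n (\<lambda>(i, j). \<Sum>k<m. complex_of_real (p k) * ket_bra (v k) $$ (i, j)))
    = (\<Sum>i<n. \<Sum>j<n. \<Sum>k<m. complex_of_real (p k) * (H $$ (i, j) * v k $ j * cnj (v k $ i)))"
    using H by (auto simp: mat_trace_def scalar_prod_def lessThan_atLeast0[symmetric] ket
        sum_distrib_left algebra_simps intro!: sum.cong)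
  also have "\<dots> = (\<Sum>k<m. \<Sum>i<n. \<Sum>j<n. complex_of_real (p k) * (H $$ (i, j) * v k $ j * cnj (v k $ i)))"
    by (subst sum.swap[of _ "{..<m}"]) (intro sum.cong refl sum.swap)
  also have "\<dots> = (\<Sum>k<m. complex_of_real (p k) * energy H (v k))"
    using H v by (simp add: energy_def cscalar_mult_mat_vec_sum sum_distrib_left)
  finally show ?thesis .
qed

text \<open>The entries of \<open>ket_bra v\<close> factor, so the double sum is an inner product
  times its conjugate. This gives positivity of the projector.\<close>

lemma ket_bra_form:
  assumes "v \<in> carrier_vec n" "u \<in> carrier_vec n"
  shows "(ket_bra v *\<^sub>v u) \<bullet>c u = complex_of_real ((cmod (u \<bullet>c v))\<^sup>2)"
proof -
  have "ket_bra v \<in> carrier_mat n n" using assms by (auto simp: ket_bra_def)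
  then have "(ket_bra v *\<^sub>v u) \<bullet>c u =
      (\<Sum>i<n. \<Sum>j<n. ket_bra v $$ (i, j) * u $ j * cnj (u $ i))"
    using assms(2) by (intro cscalar_mult_mat_vec_sum)
  also have "\<dots> = (\<Sum>i<n. \<Sum>j<n. cnj (u $ i * cnj (v $ i)) * (u $ j * cnj (v $ j)))"
    using assms by (intro sum.cong refl) (auto simp: ket_bra_def)
  also have "\<dots> = cnj (u \<bullet>c v) * (u \<bullet>c v)"
    by (simp only: cscalar_prod_sum[OF assms(2,1)] cnj_sum sum_product)
  finally show ?thesis by (simp add: complex_norm_square mult.commute del: of_real_power)
qed

lemma density_operator_ket_bra:
  assumes "v \<in> unit_sphere n"
  shows "density_operator n (ket_bra v)"
proof -
  have v: "v \<in> carrier_vec n" "v \<bullet>c v = 1"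
    using assms by (auto simp: unit_sphere_def is_unit_vector_def)
  have "mat_adjoint (ket_bra v) = ket_bra v"
    by (intro eq_matI) (auto simp: mat_adjoint_def mat_of_rows_def ket_bra_def)
  moreover have "mat_trace (ket_bra v) = v \<bullet>c v"
    using v(1) by (auto simp: mat_trace_def ket_bra_def cscalar_prod_sum intro!: sum.cong)
  moreover have "0 \<le> (ket_bra v *\<^sub>v u) \<bullet>c u" if "u \<in> carrier_vec n" for u
    unfolding ket_bra_form[OF v(1) that] by (simp add: less_eq_complex_def)
  ultimately show ?thesis
    using v by (auto simp: density_operator_def hermitian_mat_def ket_bra_def)
qed

text \<open>A mixture with one term of weight 1.\<close>

lemma ket_bra_separable:
  assumes "v \<in> unit_products ds"
  shows "ket_bra v \<in> separable_states ds"
proof -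
  have v: "v \<in> unit_sphere (prod_list ds)" using assms unit_products_subset by auto
  then have "ket_bra v = mat (prod_list ds) (prod_list ds)
      (\<lambda>(i, j). \<Sum>k<(1::nat). complex_of_real 1 * ket_bra v $$ (i, j))"
    by (intro eq_matI) (auto simp: ket_bra_def unit_sphere_def lessThan_Suc)
  then show ?thesis
    using assms density_operator_ket_bra[OF v] unfolding separable_states_def mem_Collect_eq
    by (intro conjI exI[of _ "1::nat"] exI[of _ "\<lambda>_. 1"] exI[of _ "\<lambda>_. ket_bra v"])
       (auto simp: pure_product_state_iff)
qed

lemma mat_trace_mult_ket_bra:
  assumes "H \<in> carrier_mat n n" "v \<in> carrier_vec n"
  shows "mat_trace (H * ket_bra v) = energy H v"
proof -
  have "mat n n (\<lambda>(i, j). \<Sum>k<Suc 0. complex_of_real 1 * ket_bra v $$ (i, j)) = ket_bra v"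
    using assms(2) by (intro eq_matI) (auto simp: ket_bra_def lessThan_Suc)
  then show ?thesis using mat_trace_mult_mixture[OF assms(1), of "Suc 0" "\<lambda>_. v" "\<lambda>_. 1"] assms(2) by simp
qed

text \<open>The value is attained by the projector onto \<open>v\<close>, and a weighted average of
  energies of unit product vectors cannot fall below the least of them.\<close>

lemma min_separable_energy_eq:
  assumes H: "hermitian_mat H" "H \<in> carrier_mat (prod_list ds) (prod_list ds)"
    and v: "v \<in> unit_products ds"
    and min: "\<And>u. u \<in> unit_products ds \<Longrightarrow> Re (energy H v) \<le> Re (energy H u)"
  shows "min_separable_energy ds H = Re (energy H v)"
  unfolding min_separable_energy_def
proof (rule Least_equality)
  have sub: "u \<in> carrier_vec (prod_list ds)" if "u \<in> unit_products ds" for u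
    using that unit_products_subset by (auto simp: unit_sphere_def)
  show "\<exists>\<rho>\<in>separable_states ds. mat_trace (H * \<rho>) = complex_of_real (Re (energy H v))"
    using ket_bra_separable[OF v] mat_trace_mult_ket_bra[OF H(2) sub[OF v]]
      energy_real[OF H sub[OF v]] by metis
  fix e
  assume "\<exists>\<rho>\<in>separable_states ds. mat_trace (H * \<rho>) = complex_of_real e"
  then obtain \<rho> where \<rho>: "\<rho> \<in> separable_states ds" and e: "mat_trace (H * \<rho>) = complex_of_real e"
    by blast
  from \<rho> obtain m :: nat and p :: "nat \<Rightarrow> real" and P :: "nat \<Rightarrow> complex mat"
    where P: "\<forall>k<m. 0 \<le> p k \<and> pure_product_state ds (P k)"
    and p: "(\<Sum>k<m. p k) = 1"
    and mix: "\<rho> = mat (prod_list ds) (prod_list ds)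
              (\<lambda>(i, j). \<Sum>k<m. complex_of_real (p k) * P k $$ (i, j))"
    unfolding separable_states_def mem_Collect_eq by (elim conjE exE) iprover
  \<comment> \<open>The bound on \<open>k\<close> sits inside the existential, so that a total
    choice function \<open>u\<close> can be extracted.\<close>
  from P have "\<forall>k. \<exists>u. k < m \<longrightarrow> u \<in> unit_products ds \<and> P k = ket_bra u"
    unfolding pure_product_state_iff by blast
  then obtain u where u: "\<And>k. k < m \<Longrightarrow> u k \<in> unit_products ds" "\<And>k. k < m \<Longrightarrow> P k = ket_bra (u k)"
    by metis
  have "complex_of_real e = (\<Sum>k<m. complex_of_real (p k) * energy H (u k))"
    using mat_trace_mult_mixture[OF H(2), of m u p] u sub e mix by simp
  from arg_cong[OF this, of Re] have "e = (\<Sum>k<m. p k * Re (energy H (u k)))"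
    by simp
  also have "\<dots> \<ge> (\<Sum>k<m. p k * Re (energy H v))"
    using P u(1) min by (intro sum_mono mult_left_mono) auto
  finally show "Re (energy H v) \<le> e" using p by (simp flip: sum_distrib_right)
qed

lemma energy_eigenvector:
  assumes "H \<in> carrier_mat n n" "v \<in> carrier_vec n" "H *\<^sub>v v = a \<cdot>\<^sub>v v"
  shows "energy H v = a * (v \<bullet>c v)"
  using assms by (simp add: energy_def)

text \<open>Quadratic scaling extends the minimality from the sphere to all vectors, as
  \<open>minimizer_is_eigenvector\<close> requires. Conversely, a real eigenvalue is the energy of a
  normalised eigenvector, so none lies below the minimum.\<close>

lemma ground_energy_minimizer:
  assumes H: "hermitian_mat H" "H \<in> carrier_mat n n" and v: "v \<in> unit_sphere n"
    and min: "\<And>u. u \<in> unit_sphere n \<Longrightarrow> Re (energy H v) \<le> Re (energy H u)"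
  shows "ground_energy H = Re (energy H v)" and "ground_state H v"
proof -
  have vc: "v \<in> carrier_vec n" "v \<bullet>c v = 1"
    using v by (auto simp: unit_sphere_def is_unit_vector_def)
  \<comment> \<open>In dimension 0 the inner product is an empty sum and could not be 1.\<close>
  have n: "1 \<le> n" using vc by (cases n) (auto simp: scalar_prod_def)
  have scaled: "\<exists>c\<ge>0. \<exists>w\<in>unit_sphere n. u = complex_of_real c \<cdot>\<^sub>v w \<and>
      Re (u \<bullet>c u) = c\<^sup>2 \<and> Re (energy H u) = c\<^sup>2 * Re (energy H w)"
    if u: "u \<in> carrier_vec n" for u
  proof -
    obtain c w where c: "0 \<le> c" "w \<in> unit_sphere n" "u = complex_of_real c \<cdot>\<^sub>v w"
      using vec_eq_smult_unit[OF u n] by blast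
    have w: "w \<in> carrier_vec n" "w \<bullet>c w = 1"
      using c by (auto simp: unit_sphere_def is_unit_vector_def)
    have "u \<bullet>c u = complex_of_real (c\<^sup>2)"
      using w by (simp add: c(3) conjugate_smult_vec power2_eq_square)
    moreover have "energy H u = complex_of_real (c\<^sup>2) * energy H w"
      using w(1) H(2) unfolding energy_def c(3)
      by (subst mult_mat_vec[of _ n n]) (auto simp: conjugate_smult_vec power2_eq_square)
    ultimately show ?thesis using c by (intro exI[of _ c]) (auto simp del: of_real_power)
  qed
  have "Re (energy H v) * Re (u \<bullet>c u) \<le> Re (energy H u)" if "u \<in> carrier_vec n" for u
    using scaled[OF that] min by (metis mult.commute mult_left_mono zero_le_power2)
  then have ev: "H *\<^sub>v v = complex_of_real (Re (energy H v)) \<cdot>\<^sub>v v"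
    using vc by (intro minimizer_is_eigenvector[OF H]) auto
  have "v \<noteq> 0\<^sub>v n" using vc by auto
  with ev vc(1) H(2) have eig: "eigenvector H v (complex_of_real (Re (energy H v)))"
    by (simp add: eigenvector_def)
  show E: "ground_energy H = Re (energy H v)"
    unfolding ground_energy_def
  proof (rule Least_equality)
    show "eigenvalue H (complex_of_real (Re (energy H v)))"
      using eig by (auto simp: eigenvalue_def)
    fix e assume "eigenvalue H (complex_of_real e)"
    then obtain u where u: "u \<in> carrier_vec n" "u \<noteq> 0\<^sub>v n" "H *\<^sub>v u = complex_of_real e \<cdot>\<^sub>v u"
      using H(2) by (auto simp: eigenvalue_def eigenvector_def)
    \<comment> \<open>Here \<open>w\<close> is the normalised eigenvector; comparing the two
      expressions for the energy of \<open>u\<close> and cancelling the square of \<open>c\<close>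
      gives \<open>w\<close> the energy \<open>e\<close>.\<close>
    obtain c w where c: "0 \<le> c" "w \<in> unit_sphere n" "u = complex_of_real c \<cdot>\<^sub>v w"
      "Re (u \<bullet>c u) = c\<^sup>2" "Re (energy H u) = c\<^sup>2 * Re (energy H w)"
      using scaled[OF u(1)] by auto
    have "c \<noteq> 0" using u(2) c(2,3) by (auto simp: unit_sphere_def)
    have "Re (energy H u) = e * c\<^sup>2"
      using energy_eigenvector[OF H(2) u(1,3)] c(4) by simp
    with c(5) \<open>c \<noteq> 0\<close> have "Re (energy H w) = e" by simp
    with min[OF c(2)] show "Re (energy H v) \<le> e" by simp
  qed
  show "ground_state H v"
    using eig v by (simp add: ground_state_def E unit_sphere_def)
qed

theorem mainTheorem1:
  fixes ds :: "nat list" and H :: "complex mat"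
  assumes "ds \<noteq> []" and "\<forall>d \<in> set ds. 1 \<le> d"
    and "H \<in> carrier_mat (prod_list ds) (prod_list ds)" and "hermitian_mat H"
  shows "entanglement_gap ds H > 0 \<longleftrightarrow> \<not> (\<exists>\<psi>. ground_state H \<psi> \<and> product_vector ds \<psi>)"
proof -
  let ?n = "prod_list ds"
  \<comment> \<open>\<open>s\<close> realises the minimum separable energy; \<open>g\<close> below
    realises the ground-state energy.\<close>
  obtain s where s: "s \<in> unit_products ds"
    and s_min: "\<And>u. u \<in> unit_products ds \<Longrightarrow> Re (energy H s) \<le> Re (energy H u)"
    using energy_attains_min[OF assms(3) vec_seq_compact_unit_products unit_products_nonempty]
      assms(2) by blast
  have s_unit: "s \<in> unit_sphere ?n" using s unit_products_subset by auto
  then have "unit_sphere ?n \<noteq> {}" by auto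
  then obtain g where g: "g \<in> unit_sphere ?n"
    and g_min: "\<And>u. u \<in> unit_sphere ?n \<Longrightarrow> Re (energy H g) \<le> Re (energy H u)"
    using energy_attains_min[OF assms(3) vec_seq_compact_unit_sphere] by blast
  have E0: "ground_energy H = Re (energy H g)"
    using ground_energy_minimizer(1)[OF assms(4,3) g] g_min by blast
  have gap: "entanglement_gap ds H = Re (energy H s) - Re (energy H g)"
    unfolding entanglement_gap_def E0
    using min_separable_energy_eq[OF assms(4,3) s] s_min by simp
  show ?thesis
  proof
    assume pos: "entanglement_gap ds H > 0"
    show "\<not> (\<exists>\<psi>. ground_state H \<psi> \<and> product_vector ds \<psi>)"
    proof
      assume "\<exists>\<psi>. ground_state H \<psi> \<and> product_vector ds \<psi>"
      then obtain \<psi> where \<psi>: "ground_state H \<psi>" "product_vector ds \<psi>" by blast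
      \<comment> \<open>Once its factors are normalised, the separable ground state competes with
        \<open>s\<close>, so the separable minimum is at most the ground-state energy.\<close>
      then have "\<psi> \<in> unit_products ds"
        using assms(2) by (intro unit_product_vector_in_unit_products) (auto simp: ground_state_def)
      then have "Re (energy H s) \<le> Re (energy H \<psi>)" by (rule s_min)
      moreover have "energy H \<psi> = complex_of_real (ground_energy H)"
        using \<psi>(1) assms(3) energy_eigenvector[of H ?n \<psi>]
        by (auto simp: ground_state_def eigenvector_def is_unit_vector_def)
      ultimately show False using pos gap E0 by simp
    qed
  next
    assume none: "\<not> (\<exists>\<psi>. ground_state H \<psi> \<and> product_vector ds \<psi>)"
    show "entanglement_gap ds H > 0"
    proof (rule ccontr)
      assume "\<not> entanglement_gap ds H > 0"
      \<comment> \<open>Without a positive gap, \<open>s\<close> has energy at most that of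
        \<open>g\<close>, so \<open>s\<close> minimises over the whole sphere and is itself a ground
        state.\<close>
      then have "Re (energy H s) \<le> Re (energy H u)" if "u \<in> unit_sphere ?n" for u
        using gap g_min[OF that] by linarith
      then have "ground_state H s"
        by (rule ground_energy_minimizer(2)[OF assms(4,3) s_unit])
      with none unit_products_product_vector[OF s] show False by blast
    qed
  qed
qed

end
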